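(* Let $(X,\mu)$ be a measure space. The algebra $L^{\infty}(X,\mu)$ is finite dimensional if and only if every subalgebra of $L^{\infty}(X,\mu)$ is self-adjoint.
   Context: $L^{\infty}(X,\mu)$ denotes the complex algebra, under pointwise operations, of essentially bounded measurable functions $X\to\mathbb{C}$, modulo equality $\mu$-almost everywhere. A subalgebra is a complex linear subspace closed under multiplication; it is not required to contain the constant function $1$, nor to be closed in any topology. A subalgebra $\mathcal{A}$ is self-adjoint if $f\in\mathcal{A}$ implies $\overline{f}\in\mathcal{A}$, where $\overline{f}$ is the pointwise complex conjugate of $f$. *)

theory Defs
  imports "HOL-Analysis.Analysis" "Jordan_Normal_Form.VS_Connect"
begin

definition ess_bounded :: "'a measure \<Rightarrow> ('a \<Rightarrow> complex) set" where
  "ess_bounded M = {f \<in> borel_measurable M. \<exists>C. AE x in M. norm (f x) \<le> C}"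

definition ae_rel :: "'a measure \<Rightarrow> (('a \<Rightarrow> complex) \<times> ('a \<Rightarrow> complex)) set" where
  "ae_rel M = {(f, g). f \<in> ess_bounded M \<and> g \<in> ess_bounded M \<and> (AE x in M. f x = g x)}"

definition ae_class :: "'a measure \<Rightarrow> ('a \<Rightarrow> complex) \<Rightarrow> ('a \<Rightarrow> complex) set" where
  "ae_class M f = ae_rel M `` {f}"

text \<open>The elements of \<open>Linf M\<close> are equivalence classes. Each union below ranges over
  representatives that all yield the same class, so its value is the class of the pointwise
  operation on any representatives; see \<open>Linf_add\<close>, \<open>Linf_mult\<close>, \<open>Linf_smult\<close> and
  \<open>Linf_cnj_class\<close>.\<close>

definition Linf :: "'a measure \<Rightarrow> (complex, ('a \<Rightarrow> complex) set) module" where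
  "Linf M =
    \<lparr>carrier = ess_bounded M // ae_rel M,
     mult = (\<lambda>F G. \<Union>f\<in>F. \<Union>g\<in>G. ae_class M (\<lambda>x. f x * g x)),
     one = ae_class M (\<lambda>_. 1),
     zero = ae_class M (\<lambda>_. 0),
     add = (\<lambda>F G. \<Union>f\<in>F. \<Union>g\<in>G. ae_class M (\<lambda>x. f x + g x)),
     smult = (\<lambda>c F. \<Union>f\<in>F. ae_class M (\<lambda>x. c * f x))\<rparr>"

definition Linf_cnj :: "'a measure \<Rightarrow> ('a \<Rightarrow> complex) set \<Rightarrow> ('a \<Rightarrow> complex) set" where
  "Linf_cnj M F = (\<Union>f\<in>F. ae_class M (\<lambda>x. cnj (f x)))"

text \<open>Subalgebras are not required to contain \<open>\<one>\<close>, unlike those of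
  \<open>HOL-Algebra.Embedded_Algebras\<close>.\<close>

definition nonunital_subalgebra ::
  "('k, 'm) ring_scheme \<Rightarrow> 'v set \<Rightarrow> ('k, 'v, 'n) module_scheme \<Rightarrow> bool" where
  "nonunital_subalgebra K A V \<longleftrightarrow>
     VectorSpace.subspace K A V \<and> (\<forall>x\<in>A. \<forall>y\<in>A. x \<otimes>\<^bsub>V\<^esub> y \<in> A)"

definition self_adjoint :: "'a measure \<Rightarrow> ('a \<Rightarrow> complex) set set \<Rightarrow> bool" where
  "self_adjoint M A \<longleftrightarrow> (\<forall>F\<in>A. Linf_cnj M F \<in> A)"

lemma ess_bounded_const: "(\<lambda>_. c) \<in> ess_bounded M"
  unfolding ess_bounded_def by (auto intro!: exI[of _ "norm c"])

lemma ess_bounded_add: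
  assumes "f \<in> ess_bounded M" "g \<in> ess_bounded M"
  shows "(\<lambda>x. f x + g x) \<in> ess_bounded M"
proof -
  obtain C D where C: "AE x in M. norm (f x) \<le> C" and D: "AE x in M. norm (g x) \<le> D"
    using assms unfolding ess_bounded_def by blast
  have "AE x in M. norm (f x + g x) \<le> C + D"
    using C D by eventually_elim (rule norm_triangle_mono)
  then show ?thesis using assms unfolding ess_bounded_def by auto
qed

lemma ess_bounded_mult:
  assumes "f \<in> ess_bounded M" "g \<in> ess_bounded M"
  shows "(\<lambda>x. f x * g x) \<in> ess_bounded M"
proof -
  obtain C D where C: "AE x in M. norm (f x) \<le> C" and D: "AE x in M. norm (g x) \<le> D"
    using assms unfolding ess_bounded_def by blast
  have "AE x in M. norm (f x * g x) \<le> C * D"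
    using C D
  proof eventually_elim
    case (elim x)
    have "0 \<le> C" using elim(1) norm_ge_zero order_trans by blast
    then show ?case using elim by (simp add: norm_mult mult_mono)
  qed
  then show ?thesis using assms unfolding ess_bounded_def by auto
qed

lemma ess_bounded_cmult: "f \<in> ess_bounded M \<Longrightarrow> (\<lambda>x. c * f x) \<in> ess_bounded M"
  by (rule ess_bounded_mult[OF ess_bounded_const])

lemma ess_bounded_cnj: "f \<in> ess_bounded M \<Longrightarrow> (\<lambda>x. cnj (f x)) \<in> ess_bounded M"
  unfolding ess_bounded_def by (auto intro!: borel_measurable_continuous_on[of cnj] continuous_intros)

lemma equiv_ae_rel: "equiv (ess_bounded M) (ae_rel M)"
proof (rule equivI)
  show "refl_on (ess_bounded M) (ae_rel M)"
    unfolding ae_rel_def refl_on_def by auto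
  show "ae_rel M \<subseteq> ess_bounded M \<times> ess_bounded M"
    unfolding ae_rel_def by auto
  show "sym (ae_rel M)"
    unfolding ae_rel_def sym_def by (auto simp: eq_commute)
  show "trans (ae_rel M)"
  proof (rule transI)
    fix f g h assume fg: "(f, g) \<in> ae_rel M" and gh: "(g, h) \<in> ae_rel M"
    have "AE x in M. f x = g x" "AE x in M. g x = h x"
      using fg gh unfolding ae_rel_def by auto
    then have "AE x in M. f x = h x" by eventually_elim simp
    then show "(f, h) \<in> ae_rel M" using fg gh unfolding ae_rel_def by auto
  qed
qed

lemma ae_class_eq_iff:
  "\<lbrakk>f \<in> ess_bounded M; g \<in> ess_bounded M\<rbrakk> \<Longrightarrow>
    ae_class M f = ae_class M g \<longleftrightarrow> (AE x in M. f x = g x)"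
  unfolding ae_class_def using eq_equiv_class_iff[OF equiv_ae_rel, of f M g] by (simp add: ae_rel_def del: Image_singleton_iff)

lemma mem_ae_class_iff:
  "g \<in> ae_class M f \<longleftrightarrow> f \<in> ess_bounded M \<and> g \<in> ess_bounded M \<and> (AE x in M. f x = g x)"
  unfolding ae_class_def ae_rel_def by auto

lemma carrier_Linf: "carrier (Linf M) = ae_class M ` ess_bounded M"
  unfolding Linf_def quotient_def ae_class_def by auto

lemma UN_ae_class:
  assumes f: "f \<in> ess_bounded M"
    and cong: "\<And>f'. f' \<in> ae_class M f \<Longrightarrow> P f' = P f"
  shows "(\<Union>f'\<in>ae_class M f. P f') = P f"
proof -
  have "f \<in> ae_class M f" using f by (simp add: mem_ae_class_iff)
  then show ?thesis using cong by blast
qed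

lemma UN_ae_class2:
  assumes f: "f \<in> ess_bounded M" and g: "g \<in> ess_bounded M"
    and cong: "\<And>f' g'. \<lbrakk>f' \<in> ae_class M f; g' \<in> ae_class M g\<rbrakk> \<Longrightarrow> P f' g' = P f g"
  shows "(\<Union>f'\<in>ae_class M f. \<Union>g'\<in>ae_class M g. P f' g') = P f g"
proof -
  have "f \<in> ae_class M f" "g \<in> ae_class M g" using f g by (simp_all add: mem_ae_class_iff)
  then show ?thesis using cong by blast
qed

lemma Linf_mult:
  assumes f: "f \<in> ess_bounded M" and g: "g \<in> ess_bounded M"
  shows "ae_class M f \<otimes>\<^bsub>Linf M\<^esub> ae_class M g = ae_class M (\<lambda>x. f x * g x)"
proof -
  have cong: "ae_class M (\<lambda>x. f' x * g' x) = ae_class M (\<lambda>x. f x * g x)"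
    if "f' \<in> ae_class M f" "g' \<in> ae_class M g" for f' g'
  proof -
    have f': "f' \<in> ess_bounded M" "AE x in M. f x = f' x"
      and g': "g' \<in> ess_bounded M" "AE x in M. g x = g' x"
      using that by (simp_all add: mem_ae_class_iff)
    have "AE x in M. f' x * g' x = f x * g x"
      using f'(2) g'(2) by eventually_elim simp
    then show ?thesis
      by (rule iffD2[OF ae_class_eq_iff[OF ess_bounded_mult[OF f'(1) g'(1)] ess_bounded_mult[OF f g]]])
  qed
  show ?thesis
    unfolding Linf_def using UN_ae_class2[where P = "\<lambda>f g. ae_class M (\<lambda>x. f x * g x)", OF f g cong] by simp
qed

lemma Linf_add:
  assumes f: "f \<in> ess_bounded M" and g: "g \<in> ess_bounded M"
  shows "ae_class M f \<oplus>\<^bsub>Linf M\<^esub> ae_class M g = ae_class M (\<lambda>x. f x + g x)"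
proof -
  have cong: "ae_class M (\<lambda>x. f' x + g' x) = ae_class M (\<lambda>x. f x + g x)"
    if "f' \<in> ae_class M f" "g' \<in> ae_class M g" for f' g'
  proof -
    have f': "f' \<in> ess_bounded M" "AE x in M. f x = f' x"
      and g': "g' \<in> ess_bounded M" "AE x in M. g x = g' x"
      using that by (simp_all add: mem_ae_class_iff)
    have "AE x in M. f' x + g' x = f x + g x"
      using f'(2) g'(2) by eventually_elim simp
    then show ?thesis
      by (rule iffD2[OF ae_class_eq_iff[OF ess_bounded_add[OF f'(1) g'(1)] ess_bounded_add[OF f g]]])
  qed
  show ?thesis
    unfolding Linf_def using UN_ae_class2[where P = "\<lambda>f g. ae_class M (\<lambda>x. f x + g x)", OF f g cong] by simp
qed

lemma Linf_smult:
  assumes f: "f \<in> ess_bounded M"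
  shows "c \<odot>\<^bsub>Linf M\<^esub> ae_class M f = ae_class M (\<lambda>x. c * f x)"
proof -
  have cong: "ae_class M (\<lambda>x. c * f' x) = ae_class M (\<lambda>x. c * f x)"
    if "f' \<in> ae_class M f" for f'
  proof -
    have f': "f' \<in> ess_bounded M" "AE x in M. f x = f' x"
      using that by (simp_all add: mem_ae_class_iff)
    have "AE x in M. c * f' x = c * f x"
      using f'(2) by eventually_elim simp
    then show ?thesis
      by (rule iffD2[OF ae_class_eq_iff[OF ess_bounded_cmult[OF f'(1)] ess_bounded_cmult[OF f]]])
  qed
  show ?thesis
    unfolding Linf_def using UN_ae_class[where P = "\<lambda>f. ae_class M (\<lambda>x. c * f x)", OF f cong] by simp
qed

lemma Linf_cnj_class:
  assumes f: "f \<in> ess_bounded M"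
  shows "Linf_cnj M (ae_class M f) = ae_class M (\<lambda>x. cnj (f x))"
proof -
  have cong: "ae_class M (\<lambda>x. cnj (f' x)) = ae_class M (\<lambda>x. cnj (f x))"
    if "f' \<in> ae_class M f" for f'
  proof -
    have f': "f' \<in> ess_bounded M" "AE x in M. f x = f' x"
      using that by (simp_all add: mem_ae_class_iff)
    have "AE x in M. cnj (f' x) = cnj (f x)"
      using f'(2) by eventually_elim simp
    then show ?thesis
      by (rule iffD2[OF ae_class_eq_iff[OF ess_bounded_cnj[OF f'(1)] ess_bounded_cnj[OF f]]])
  qed
  show ?thesis
    unfolding Linf_cnj_def using UN_ae_class[where P = "\<lambda>f. ae_class M (\<lambda>x. cnj (f x))", OF f cong] by simp
qed

lemma Linf_zero: "\<zero>\<^bsub>Linf M\<^esub> = ae_class M (\<lambda>_. 0)"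
  and Linf_one: "\<one>\<^bsub>Linf M\<^esub> = ae_class M (\<lambda>_. 1)"
  unfolding Linf_def by simp_all

lemmas Linf_simps = carrier_Linf Linf_mult Linf_add Linf_smult Linf_zero Linf_one
  ess_bounded_const ess_bounded_add ess_bounded_mult ess_bounded_cmult

lemma cring_Linf: "cring (Linf M)"
proof (rule cringI)
  show "abelian_group (Linf M)"
  proof (rule abelian_groupI)
    fix F assume "F \<in> carrier (Linf M)"
    then obtain f where f: "f \<in> ess_bounded M" "F = ae_class M f" by (auto simp: carrier_Linf)
    have "ae_class M (\<lambda>x. - 1 * f x) \<oplus>\<^bsub>Linf M\<^esub> F = \<zero>\<^bsub>Linf M\<^esub>"
      unfolding f(2) Linf_add[OF ess_bounded_cmult[OF f(1)] f(1)] by (simp add: Linf_zero)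
    then show "\<exists>G\<in>carrier (Linf M). G \<oplus>\<^bsub>Linf M\<^esub> F = \<zero>\<^bsub>Linf M\<^esub>"
      unfolding carrier_Linf using ess_bounded_cmult[OF f(1)] by blast
  qed (auto simp: Linf_simps add_ac)
  show "comm_monoid (Linf M)"
    by (rule comm_monoidI) (auto simp: Linf_simps mult_ac)
qed (auto simp: Linf_simps distrib_right)

lemma algebra_Linf: "algebra class_ring (Linf M)"
  by (rule algebraI)
     (auto simp: Linf_simps algebra_simps class_cring.is_cring cring_Linf)

lemma vectorspace_Linf: "vectorspace class_ring (Linf M)"
  using algebra_Linf class_field.field_axioms
  unfolding vectorspace_def algebra_def by blast

end

theory Submission
  imports Defs
begin

text \<open>
  Everything comes down to one question: when is the complex conjugate of a bounded function \<open>f\<close>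
  a polynomial without constant term in \<open>f\<close>? Such polynomials in \<open>f\<close> lie in every subalgebra that
  contains \<open>f\<close> (\<open>poly_comp_in_subalgebra\<close>), and together they form one (\<open>poly_subalgebra\<close>).

  Suppose that \<open>L\<^sup>\<infinity>\<close> is finite dimensional. The powers of \<open>f\<close> are then linearly dependent, so
  some nonzero polynomial annihilates \<open>f\<close> (\<open>fin_dim_imp_algebraic\<close>), and almost all values of \<open>f\<close>
  lie in its finite root set. A polynomial that interpolates conjugation on these roots and vanishes
  at \<open>0\<close> carries \<open>f\<close> to its conjugate, so every subalgebra containing \<open>f\<close> contains the conjugate
  as well.

  Suppose conversely that every subalgebra is self-adjoint, and let \<open>f\<close> be unimodular. The conjugate
  of \<open>f\<close> is then \<open>f \<cdot> p(f)\<close> for some polynomial \<open>p\<close>, and \<open>f \<cdot> cnj f = 1\<close> says that \<open>f\<close> is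
  annihilated by \<open>z\<^sup>2 p(z) - 1\<close>. This polynomial is nonzero because its value at \<open>0\<close> is \<open>-1\<close>, so \<open>f\<close> has only
  finitely many essential values (\<open>self_adjoint_imp_unimodular_algebraic\<close>). If \<open>L\<^sup>\<infinity>\<close> were
  infinite dimensional, infinitely many pairwise disjoint sets of positive measure could be split off
  the space one after another (\<open>exists_strictly_decreasing_sets\<close>), and a function with infinitely
  many unimodular values, each on a non-null set, would result. The splitting rests on the fact that
  a measurable function on an indivisible set is constant almost everywhere
  (\<open>AE_constant_if_indivisible\<close>), so that an indivisible set contributes only one dimension.
\<close>

section \<open>Polynomials in an essentially bounded function\<close>

lemma ess_bounded_poly:
  assumes "f \<in> ess_bounded M"
  shows "(\<lambda>x. poly p (f x)) \<in> ess_bounded M"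
  by (induction p) (simp_all add: ess_bounded_const ess_bounded_add ess_bounded_mult assms)

lemma Linf_class_cong:
  assumes "f \<in> ess_bounded M" "g \<in> ess_bounded M" "AE x in M. f x = g x"
  shows "ae_class M f = ae_class M g"
  using assms by (simp add: ae_class_eq_iff)

lemma submodule_if_nonunital_subalgebra:
  "nonunital_subalgebra K A V \<Longrightarrow> submodule K A V"
  by (simp add: nonunital_subalgebra_def VectorSpace.subspace_def)

text \<open>A polynomial that vanishes at \<open>0\<close> is \<open>z \<cdot> q(z)\<close>, which is the form used here. Horner's scheme
  \<open>f \<cdot> (c + f \<cdot> r(f)) = c f + f \<cdot> (f \<cdot> r(f))\<close> evaluates it without ever using the constant
  function \<open>1\<close>.\<close>

lemma poly_comp_in_subalgebra:
  assumes A: "nonunital_subalgebra class_ring A (Linf M)"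
    and f: "f \<in> ess_bounded M" "ae_class M f \<in> A"
  shows "ae_class M (\<lambda>x. f x * poly q (f x)) \<in> A"
proof (induction q)
  case 0
  show ?case
    using submodule.zero_closed[OF submodule_if_nonunital_subalgebra[OF A]] by (simp add: Linf_zero)
next
  case (pCons c r)
  have fr: "(\<lambda>x. f x * poly r (f x)) \<in> ess_bounded M"
    by (rule ess_bounded_mult[OF f(1) ess_bounded_poly[OF f(1)]])
  have "ae_class M (\<lambda>x. c * f x) \<in> A"
    using submodule.smult_closed[OF submodule_if_nonunital_subalgebra[OF A] _ f(2), of c]
    by (simp add: Linf_smult f(1))
  moreover have "ae_class M (\<lambda>x. f x * (f x * poly r (f x))) \<in> A"
    using A f(2) pCons.IH
    unfolding nonunital_subalgebra_def Linf_mult[OF f(1) fr, symmetric] by blast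
  ultimately have
    "ae_class M (\<lambda>x. c * f x) \<oplus>\<^bsub>Linf M\<^esub> ae_class M (\<lambda>x. f x * (f x * poly r (f x))) \<in> A"
    using submodule.m_closed[OF submodule_if_nonunital_subalgebra[OF A]] by blast
  also have "ae_class M (\<lambda>x. c * f x) \<oplus>\<^bsub>Linf M\<^esub> ae_class M (\<lambda>x. f x * (f x * poly r (f x)))
      = ae_class M (\<lambda>x. f x * poly (pCons c r) (f x))"
    by (subst Linf_add[OF ess_bounded_cmult[OF f(1)] ess_bounded_mult[OF f(1) fr]])
      (simp add: algebra_simps)
  finally show ?case .
qed

lemma poly_subalgebra:
  assumes f: "f \<in> ess_bounded M"
  shows "nonunital_subalgebra class_ring (range (\<lambda>q. ae_class M (\<lambda>x. f x * poly q (f x)))) (Linf M)"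
    (is "nonunital_subalgebra _ (range ?P) _")
proof -
  have eb: "(\<lambda>x. f x * poly q (f x)) \<in> ess_bounded M" for q
    by (rule ess_bounded_mult[OF f ess_bounded_poly[OF f]])
  have add: "?P p \<oplus>\<^bsub>Linf M\<^esub> ?P q = ?P (p + q)" for p q
    by (simp add: Linf_add eb algebra_simps)
  have smult: "c \<odot>\<^bsub>Linf M\<^esub> ?P q = ?P (Polynomial.smult c q)" for c q
    by (simp add: Linf_smult eb algebra_simps)
  have mult: "?P p \<otimes>\<^bsub>Linf M\<^esub> ?P q = ?P (p * pCons 0 q)" for p q
    by (simp add: Linf_mult eb algebra_simps)
  have zero: "\<zero>\<^bsub>Linf M\<^esub> = ?P 0"
    by (simp add: Linf_zero)
  have "submodule class_ring (range ?P) (Linf M)"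
  proof (rule submodule.intro)
    show "Module.module class_ring (Linf M)"
      using vectorspace_Linf[of M] by (simp add: vectorspace_def)
    show "range ?P \<subseteq> carrier (Linf M)"
      using eb by (auto simp: carrier_Linf)
    show "\<zero>\<^bsub>Linf M\<^esub> \<in> range ?P" unfolding zero by blast
  qed (use add smult in \<open>auto simp del: poly_add poly_smult\<close>)
  moreover have "F \<otimes>\<^bsub>Linf M\<^esub> G \<in> range ?P" if "F \<in> range ?P" "G \<in> range ?P" for F G
    using that mult by blast
  ultimately show ?thesis
    using vectorspace_Linf[of M]
    unfolding nonunital_subalgebra_def VectorSpace.subspace_def by blast
qed

lemma poly_interpolation_exists:
  fixes S :: "'k::field set"
  assumes "finite S"
  shows "\<exists>p. \<forall>z\<in>S. poly p z = h z"
  using assms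
proof (induction S)
  case empty
  show ?case by simp
next
  case (insert s S)
  then obtain p where p: "\<forall>z\<in>S. poly p z = h z" by blast
  define w where "w = (\<Prod>z\<in>S. [:- z, 1:])"
  have w: "poly w z = (\<Prod>y\<in>S. z - y)" for z
    unfolding w_def by (simp add: poly_prod)
  have "poly w s \<noteq> 0" using insert.hyps by (auto simp: w)
  moreover have "poly w z = 0" if "z \<in> S" for z
    using that insert.hyps(1) by (auto simp: w)
  ultimately show ?case
    using p by (intro exI[of _ "p + Polynomial.smult ((h s - poly p s) / poly w s) w"]) auto
qed

section \<open>Finite dimension makes every subalgebra self-adjoint\<close>

lemma Linf_finsum:
  assumes "finite I" "\<And>i. i \<in> I \<Longrightarrow> g i \<in> ess_bounded M"
  shows "(\<Oplus>\<^bsub>Linf M\<^esub>i\<in>I. ae_class M (g i)) = ae_class M (\<lambda>x. \<Sum>i\<in>I. g i x)"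
    and "(\<lambda>x. \<Sum>i\<in>I. g i x) \<in> ess_bounded M"
proof -
  interpret cring "Linf M" by (rule cring_Linf)
  have "(\<Oplus>\<^bsub>Linf M\<^esub>i\<in>I. ae_class M (g i)) = ae_class M (\<lambda>x. \<Sum>i\<in>I. g i x) \<and>
      (\<lambda>x. \<Sum>i\<in>I. g i x) \<in> ess_bounded M"
    using assms
  proof (induction I)
    case empty
    show ?case by (simp add: Linf_zero ess_bounded_const)
  next
    case (insert i I)
    then show ?case
      by (subst finsum_insert) (auto simp: carrier_Linf Linf_add ess_bounded_add)
  qed
  then show "(\<Oplus>\<^bsub>Linf M\<^esub>i\<in>I. ae_class M (g i)) = ae_class M (\<lambda>x. \<Sum>i\<in>I. g i x)"
    and "(\<lambda>x. \<Sum>i\<in>I. g i x) \<in> ess_bounded M" by blast+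
qed

text \<open>Linear dependence speaks of a set of vectors, not of a family, so a repetition among the powers
  of \<open>f\<close> must be treated apart; it yields a difference of two monomials.\<close>

lemma fin_dim_imp_algebraic:
  assumes fd: "vectorspace.fin_dim class_ring (Linf M)" and f: "f \<in> ess_bounded M"
  shows "\<exists>q. q \<noteq> 0 \<and> (AE x in M. poly q (f x) = 0)"
proof -
  interpret V: vectorspace class_ring "Linf M" by (rule vectorspace_Linf)
  define P where "P n = ae_class M (\<lambda>x. f x ^ n)" for n :: nat
  have eb: "(\<lambda>x. f x ^ n) \<in> ess_bounded M" for n
    using ess_bounded_poly[OF f, of "monom 1 n"] by (simp add: poly_monom)
  show ?thesis
  proof (cases "inj P")
    case False
    then obtain i j where ij: "i \<noteq> j" "P i = P j" by (auto simp: inj_on_def)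
    have "AE x in M. f x ^ i = f x ^ j"
      using ij(2) by (simp add: P_def ae_class_eq_iff eb)
    then have "AE x in M. poly (monom 1 i - monom 1 j) (f x) = 0"
      by eventually_elim (simp add: poly_monom)
    moreover have "coeff (monom 1 i - monom 1 j :: complex poly) i = 1"
      using ij(1) by simp
    then have "monom 1 i - monom 1 j \<noteq> (0 :: complex poly)"
      by (metis coeff_0 zero_neq_one)
    ultimately show ?thesis by blast
  next
    case True
    have "infinite (range P)" using True by (simp add: finite_image_iff)
    moreover have "range P \<subseteq> carrier (Linf M)" by (auto simp: P_def carrier_Linf eb)
    ultimately have "V.lin_dep (range P)" using V.fin_dim_li_fin[OF fd] by blast
    then obtain B a v where B: "finite B" "B \<subseteq> range P" "V.lincomb a B = \<zero>\<^bsub>Linf M\<^esub>"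
      and v: "v \<in> B" "a v \<noteq> 0"
      unfolding V.lin_dep_def by auto
    obtain I where I: "B = P ` I" using B(2) by (auto simp: subset_image_iff)
    have inj: "inj_on P I" using True by (rule inj_on_subset) simp
    have fin: "finite I" using B(1) I inj by (simp add: finite_image_iff)
    obtain i where i: "i \<in> I" "v = P i" using v(1) I by blast
    define q where "q = (\<Sum>n\<in>I. monom (a (P n)) n)"
    have "coeff q i = a (P i)"
      unfolding q_def using fin i(1) by (simp add: coeff_sum coeff_monom if_distrib sum.delta)
    then have q0: "q \<noteq> 0" using v(2) i(2) by auto
    have "V.lincomb a B = (\<Oplus>\<^bsub>Linf M\<^esub>n\<in>I. a (P n) \<odot>\<^bsub>Linf M\<^esub> P n)"
      unfolding V.lincomb_def I
      by (rule V.finsum_reindex[OF _ inj]) (auto simp: P_def Linf_smult eb carrier_Linf ess_bounded_cmult)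
    also have "\<dots> = (\<Oplus>\<^bsub>Linf M\<^esub>n\<in>I. ae_class M (\<lambda>x. a (P n) * f x ^ n))"
      by (simp add: P_def Linf_smult eb)
    also have "\<dots> = ae_class M (\<lambda>x. \<Sum>n\<in>I. a (P n) * f x ^ n)"
      by (rule Linf_finsum(1)[OF fin]) (simp add: eb ess_bounded_cmult)
    also have "\<dots> = ae_class M (\<lambda>x. poly q (f x))"
      by (simp add: q_def poly_sum poly_monom)
    finally have "AE x in M. poly q (f x) = 0"
      using B(3) by (simp add: Linf_zero ae_class_eq_iff ess_bounded_poly[OF f] ess_bounded_const)
    then show ?thesis using q0 by blast
  qed
qed

lemma fin_dim_imp_self_adjoint:
  assumes fd: "vectorspace.fin_dim class_ring (Linf M)"
    and A: "nonunital_subalgebra class_ring A (Linf M)"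
  shows "self_adjoint M A"
  unfolding self_adjoint_def
proof
  fix F assume F: "F \<in> A"
  have "A \<subseteq> carrier (Linf M)"
    by (rule submodule.subset[OF submodule_if_nonunital_subalgebra[OF A]])
  then obtain f where f: "f \<in> ess_bounded M" "F = ae_class M f"
    using F by (auto simp: carrier_Linf)
  obtain q where q: "q \<noteq> 0" "AE x in M. poly q (f x) = 0"
    using fin_dim_imp_algebraic[OF fd f(1)] by blast
  \<comment> \<open>At \<open>z = 0\<close> the quotient has the default value \<open>0\<close>; there \<open>z \<cdot> r(z)\<close> equals
    \<open>0 = cnj 0\<close> in any case.\<close>
  obtain r where r: "\<forall>z\<in>{z. poly q z = 0}. poly r z = cnj z / z"
    using poly_interpolation_exists[OF poly_roots_finite[OF q(1)], of "\<lambda>z. cnj z / z"] by blast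
  have "AE x in M. f x * poly r (f x) = cnj (f x)"
    using q(2)
  proof eventually_elim
    case (elim x)
    then show ?case using r by (cases "f x = 0") auto
  qed
  then have "ae_class M (\<lambda>x. f x * poly r (f x)) = Linf_cnj M F"
    using f by (simp add: Linf_cnj_class ae_class_eq_iff ess_bounded_cnj ess_bounded_mult
        ess_bounded_poly)
  then show "Linf_cnj M F \<in> A"
    using poly_comp_in_subalgebra[OF A f(1)] f(2) F by metis
qed

section \<open>Unimodular functions when every subalgebra is self-adjoint\<close>

text \<open>On the unit circle conjugation is inversion, so a polynomial formula for the conjugate of \<open>f\<close>
  turns into the equation \<open>f \<cdot> (f \<cdot> p(f)) = 1\<close>. The subalgebra to test is the one generated by \<open>f\<close>;
  it consists of all \<open>f \<cdot> p(f)\<close>.\<close>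

lemma self_adjoint_imp_unimodular_algebraic:
  fixes f :: "'a \<Rightarrow> complex"
  assumes sa: "\<And>A. nonunital_subalgebra class_ring A (Linf M) \<Longrightarrow> self_adjoint M A"
    and f: "f \<in> borel_measurable M" "\<And>x. norm (f x) = 1"
  shows "\<exists>q. q \<noteq> 0 \<and> (AE x in M. poly q (f x) = 0)"
proof -
  have eb: "f \<in> ess_bounded M"
    using f by (auto simp: ess_bounded_def intro!: exI[of _ 1])
  let ?A = "range (\<lambda>q. ae_class M (\<lambda>x. f x * poly q (f x)))"
  have "ae_class M f = ae_class M (\<lambda>x. f x * poly 1 (f x))" by simp
  then have "ae_class M f \<in> ?A" by blast
  then have "Linf_cnj M (ae_class M f) \<in> ?A"
    using sa[OF poly_subalgebra[OF eb]] unfolding self_adjoint_def by blast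
  then obtain p where "ae_class M (\<lambda>x. cnj (f x)) = ae_class M (\<lambda>x. f x * poly p (f x))"
    using Linf_cnj_class[OF eb] by auto
  then have "AE x in M. cnj (f x) = f x * poly p (f x)"
    by (simp add: ae_class_eq_iff ess_bounded_cnj ess_bounded_mult ess_bounded_poly eb)
  then have "AE x in M. poly (pCons (- 1) (pCons 0 p)) (f x) = 0"
  proof eventually_elim
    case (elim x)
    have "f x * cnj (f x) = 1"
      using f(2)[of x] by (simp add: complex_norm_square[symmetric])
    then show ?case by (simp add: elim)
  qed
  moreover have "pCons (- 1) (pCons 0 p) \<noteq> 0" by simp
  ultimately show ?thesis by blast
qed

section \<open>Splitting sets in an infinite-dimensional space\<close>

text \<open>For each set of a countable base, \<open>f\<close> takes values in it either almost everywhere on \<open>E\<close> or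
  almost nowhere. Outside one null set, all points of \<open>E\<close> therefore have values in the same basic
  sets, and basic sets separate points.\<close>

lemma AE_constant_if_indivisible:
  fixes f :: "'a \<Rightarrow> 'b::{second_countable_topology, t2_space}"
  assumes f: "f \<in> borel_measurable M" and E: "E \<in> sets M"
    and ind: "\<And>A. \<lbrakk>A \<in> sets M; A \<subseteq> E\<rbrakk> \<Longrightarrow> A \<in> null_sets M \<or> E - A \<in> null_sets M"
  shows "\<exists>c. AE x in M. x \<in> E \<longrightarrow> f x = c"
proof -
  obtain B :: "'b set set" where B: "countable B" "topological_basis B"
    using ex_countable_basis by blast
  have "\<exists>t. AE x in M. x \<in> E \<longrightarrow> (f x \<in> U \<longleftrightarrow> t)" if "U \<in> B" for U
  proof -
    have "U \<in> sets borel" using topological_basis_open[OF B(2) that] by simp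
    then have "f -` U \<inter> space M \<in> sets M" by (rule measurable_sets[OF f])
    then have "E \<inter> (f -` U \<inter> space M) \<in> sets M" using E by simp
    then consider "E \<inter> (f -` U \<inter> space M) \<in> null_sets M"
      | "E - (E \<inter> (f -` U \<inter> space M)) \<in> null_sets M"
      using ind by blast
    then show ?thesis
    proof cases
      case 1
      then have "AE x in M. x \<in> E \<longrightarrow> (f x \<in> U \<longleftrightarrow> False)"
        using AE_not_in[OF 1] AE_space by eventually_elim auto
      then show ?thesis by blast
    next
      case 2
      then have "AE x in M. x \<in> E \<longrightarrow> (f x \<in> U \<longleftrightarrow> True)"
        using AE_not_in[OF 2] AE_space by eventually_elim auto
      then show ?thesis by blast
    qed
  qed
  then obtain t where t: "\<And>U. U \<in> B \<Longrightarrow> AE x in M. x \<in> E \<longrightarrow> (f x \<in> U \<longleftrightarrow> t U)"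
    by metis
  have ae: "AE x in M. \<forall>U\<in>B. x \<in> E \<longrightarrow> (f x \<in> U \<longleftrightarrow> t U)"
    using t B(1) by (rule AE_ball_countable')
  have same: "f x = f y"
    if "\<forall>U\<in>B. f x \<in> U \<longleftrightarrow> t U" "\<forall>U\<in>B. f y \<in> U \<longleftrightarrow> t U" for x y
  proof (rule ccontr)
    assume "f x \<noteq> f y"
    then obtain W where W: "open W" "f x \<in> W" "f y \<notin> W"
      using separation_t0[of "f x" "f y"] that hausdorff by (metis disjoint_iff)
    then obtain U where "U \<in> B" "f x \<in> U" "U \<subseteq> W" using topological_basisE[OF B(2)] by metis
    then show False using that W(3) by blast
  qed
  show ?thesis
  proof (cases "\<exists>y\<in>E. \<forall>U\<in>B. f y \<in> U \<longleftrightarrow> t U")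
    case True
    then obtain y where y: "\<forall>U\<in>B. f y \<in> U \<longleftrightarrow> t U" by blast
    have "AE x in M. x \<in> E \<longrightarrow> f x = f y"
      using ae
    proof eventually_elim
      case (elim x)
      then show ?case using same[OF _ y, of x] by blast
    qed
    then show ?thesis by blast
  next
    \<comment> \<open>Here \<open>E\<close> is null, and any constant serves.\<close>
    case False
    have "AE x in M. x \<in> E \<longrightarrow> f x = undefined"
      using ae
    proof eventually_elim
      case (elim x)
      then show ?case using False by blast
    qed
    then show ?thesis by blast
  qed
qed

text \<open>The functions supported on \<open>E\<close> form the ideal \<open>1\<^sub>E L\<^sup>\<infinity>\<close>. The spanning set may be taken from all of
  \<open>L\<^sup>\<infinity>\<close>, so that the spans belonging to different sets \<open>E\<close> live in one and the same space.\<close>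

definition finite_dim_on :: "'a measure \<Rightarrow> 'a set \<Rightarrow> bool" where
  "finite_dim_on M E \<longleftrightarrow> (\<exists>S. finite S \<and> S \<subseteq> carrier (Linf M) \<and>
    (\<forall>f\<in>ess_bounded M. ae_class M (\<lambda>x. indicator E x * f x) \<in> module.span class_ring (Linf M) S))"

lemma ess_bounded_indicator:
  fixes M :: "'a measure"
  assumes "E \<in> sets M"
  shows "(indicator E :: 'a \<Rightarrow> complex) \<in> ess_bounded M"
proof -
  have "AE x in M. norm (indicator E x :: complex) \<le> 1"
    by (rule AE_I2) (simp add: indicator_def)
  moreover have "(indicator E :: 'a \<Rightarrow> complex) \<in> borel_measurable M"
    using assms by (rule borel_measurable_indicator)
  ultimately show ?thesis unfolding ess_bounded_def by blast
qed

lemma finite_dim_on_null: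
  assumes "E \<in> null_sets M"
  shows "finite_dim_on M E"
proof -
  interpret V: vectorspace class_ring "Linf M" by (rule vectorspace_Linf)
  have "ae_class M (\<lambda>x. indicator E x * f x) \<in> V.span {}" if f: "f \<in> ess_bounded M" for f
  proof -
    have "AE x in M. indicator E x * f x = 0"
      using AE_not_in[OF assms] by eventually_elim simp
    moreover have "E \<in> sets M" using assms by auto
    ultimately have "ae_class M (\<lambda>x. indicator E x * f x) = \<zero>\<^bsub>Linf M\<^esub>"
      unfolding Linf_zero
      by (intro Linf_class_cong ess_bounded_mult ess_bounded_indicator ess_bounded_const f)
    then show ?thesis
      using submodule.zero_closed[OF V.span_is_submodule[of "{}"]] by simp
  qed
  then show ?thesis unfolding finite_dim_on_def by (intro exI[of _ "{}"]) simp
qed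

lemma finite_dim_on_Un:
  assumes "finite_dim_on M A" "finite_dim_on M B" "A \<in> sets M" "B \<in> sets M" "A \<inter> B = {}"
  shows "finite_dim_on M (A \<union> B)"
proof -
  interpret V: vectorspace class_ring "Linf M" by (rule vectorspace_Linf)
  obtain S where S: "finite S" "S \<subseteq> carrier (Linf M)"
    and spanS: "\<And>f. f \<in> ess_bounded M \<Longrightarrow> ae_class M (\<lambda>x. indicator A x * f x) \<in> V.span S"
    using assms(1) unfolding finite_dim_on_def by blast
  obtain T where T: "finite T" "T \<subseteq> carrier (Linf M)"
    and spanT: "\<And>f. f \<in> ess_bounded M \<Longrightarrow> ae_class M (\<lambda>x. indicator B x * f x) \<in> V.span T"
    using assms(2) unfolding finite_dim_on_def by blast
  have "ae_class M (\<lambda>x. indicator (A \<union> B) x * f x) \<in> V.span (S \<union> T)"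
    if f: "f \<in> ess_bounded M" for f
  proof -
    have "ae_class M (\<lambda>x. indicator A x * f x) \<in> V.span (S \<union> T)"
      "ae_class M (\<lambda>x. indicator B x * f x) \<in> V.span (S \<union> T)"
      using spanS[OF f] spanT[OF f] V.span_is_monotone[of S "S \<union> T"] V.span_is_monotone[of T "S \<union> T"]
      by auto
    moreover have "submodule class_ring (V.span (S \<union> T)) (Linf M)"
      using S(2) T(2) by (intro V.span_is_submodule) simp
    ultimately have "ae_class M (\<lambda>x. indicator A x * f x) \<oplus>\<^bsub>Linf M\<^esub>
        ae_class M (\<lambda>x. indicator B x * f x) \<in> V.span (S \<union> T)"
      by (rule submodule.m_closed[rotated])
    moreover have "indicator A x * f x + indicator B x * f x = indicator (A \<union> B) x * f x" for x
      using assms(5) by (auto simp: indicator_def)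
    ultimately show ?thesis
      by (simp add: Linf_add ess_bounded_mult ess_bounded_indicator assms(3,4) f)
  qed
  then show ?thesis
    unfolding finite_dim_on_def using S T by (intro exI[of _ "S \<union> T"]) auto
qed

lemma finite_dim_on_indivisible:
  assumes E: "E \<in> sets M"
    and ind: "\<And>A. \<lbrakk>A \<in> sets M; A \<subseteq> E\<rbrakk> \<Longrightarrow> A \<in> null_sets M \<or> E - A \<in> null_sets M"
  shows "finite_dim_on M E"
proof -
  interpret V: vectorspace class_ring "Linf M" by (rule vectorspace_Linf)
  let ?e = "ae_class M (indicator E)"
  have eb: "(indicator E :: 'a \<Rightarrow> complex) \<in> ess_bounded M" by (rule ess_bounded_indicator[OF E])
  have e: "{?e} \<subseteq> carrier (Linf M)" using eb by (auto simp: carrier_Linf)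
  have "ae_class M (\<lambda>x. indicator E x * f x) \<in> V.span {?e}" if f: "f \<in> ess_bounded M" for f
  proof -
    have "f \<in> borel_measurable M" using f by (simp add: ess_bounded_def)
    then obtain c where "AE x in M. x \<in> E \<longrightarrow> f x = c"
      using AE_constant_if_indivisible[OF _ E ind] by blast
    then have "AE x in M. indicator E x * f x = c * indicator E x"
      by eventually_elim (auto simp: indicator_def)
    then have "ae_class M (\<lambda>x. indicator E x * f x) = c \<odot>\<^bsub>Linf M\<^esub> ?e"
      unfolding Linf_smult[OF eb]
      by (intro Linf_class_cong ess_bounded_mult ess_bounded_cmult eb f)
    moreover have "?e \<in> V.span {?e}" using V.in_own_span[OF e] by simp
    ultimately show ?thesis
      using submodule.smult_closed[OF V.span_is_submodule[OF e]] by simp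
  qed
  then show ?thesis
    unfolding finite_dim_on_def using e by (intro exI[of _ "{?e}"]) simp
qed

lemma fin_dim_if_finite_dim_on_space:
  assumes "finite_dim_on M (space M)"
  shows "vectorspace.fin_dim class_ring (Linf M)"
proof -
  interpret V: vectorspace class_ring "Linf M" by (rule vectorspace_Linf)
  obtain S where S: "finite S" "S \<subseteq> carrier (Linf M)"
    and span: "\<And>f. f \<in> ess_bounded M \<Longrightarrow> ae_class M (\<lambda>x. indicator (space M) x * f x) \<in> V.span S"
    using assms unfolding finite_dim_on_def by blast
  have "ae_class M f \<in> V.span S" if f: "f \<in> ess_bounded M" for f
  proof -
    have "AE x in M. indicator (space M) x * f x = f x" by (rule AE_I2) simp
    then have "ae_class M (\<lambda>x. indicator (space M) x * f x) = ae_class M f"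
      by (intro Linf_class_cong ess_bounded_mult ess_bounded_indicator f) simp_all
    then show ?thesis using span[OF f] by simp
  qed
  then have "V.span S = carrier (Linf M)"
    using V.span_is_subset2[OF S(2)] by (auto simp: carrier_Linf)
  then show ?thesis unfolding V.fin_dim_def using S by blast
qed

text \<open>An infinite-dimensional set is divisible into two non-null parts, and at least one of them is
  again infinite dimensional. Continuing with that part leaves the other behind as a non-null
  difference.\<close>

lemma exists_strictly_decreasing_sets:
  fixes M :: "'a measure"
  assumes "\<not> finite_dim_on M (space M)"
  shows "\<exists>X :: nat \<Rightarrow> 'a set. (\<forall>n. X n \<in> sets M) \<and> (\<forall>n. X (Suc n) \<subseteq> X n) \<and>
    (\<forall>n. X n - X (Suc n) \<notin> null_sets M)"
proof -
  have step: "\<exists>D. (D \<in> sets M \<and> \<not> finite_dim_on M D) \<and> D \<subseteq> E \<and> E - D \<notin> null_sets M"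
    if E: "E \<in> sets M" "\<not> finite_dim_on M E" for E
  proof -
    obtain A where A: "A \<in> sets M" "A \<subseteq> E" "A \<notin> null_sets M" "E - A \<notin> null_sets M"
      using finite_dim_on_indivisible[OF E(1)] E(2) by blast
    have "\<not> (finite_dim_on M A \<and> finite_dim_on M (E - A))"
    proof
      assume "finite_dim_on M A \<and> finite_dim_on M (E - A)"
      then have "finite_dim_on M (A \<union> (E - A))" using A E(1) by (intro finite_dim_on_Un) auto
      moreover have "A \<union> (E - A) = E" using A(2) by blast
      ultimately show False using E(2) by simp
    qed
    moreover have "E - (E - A) = A" using A(2) by blast
    ultimately show ?thesis using A E(1) by (metis Diff_subset sets.Diff)
  qed
  have "\<exists>X :: nat \<Rightarrow> 'a set. \<forall>n. (X n \<in> sets M \<and> \<not> finite_dim_on M (X n)) \<and>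
      (X (Suc n) \<subseteq> X n \<and> X n - X (Suc n) \<notin> null_sets M)"
    by (rule dependent_nat_choice) (use assms step in auto)
  then show ?thesis by blast
qed

section \<open>Self-adjointness of all subalgebras forces finite dimension\<close>

lemma inj_cis_inverse_Suc: "inj (\<lambda>n::nat. cis (1 / real (Suc n)))"
proof (rule injI)
  fix m n :: nat
  assume eq: "cis (1 / real (Suc m)) = cis (1 / real (Suc n))"
  have le_pi: "1 / real (Suc k) \<le> pi" for k
  proof -
    have "1 / real (Suc k) \<le> 1" by simp
    then show ?thesis using pi_gt3 by linarith
  qed
  have "cos (1 / real (Suc m)) = cos (1 / real (Suc n))"
    using arg_cong[OF eq, of Re] by (simp only: cis.sel)
  then have "1 / real (Suc m) = 1 / real (Suc n)"
    by (rule cos_inj_pi[rotated 4]) (rule le_pi zero_le_divide_1_iff[THEN iffD2] of_nat_0_le_iff)+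
  then show "m = n" by simp
qed

lemma self_adjoint_imp_fin_dim:
  assumes sa: "\<And>A. nonunital_subalgebra class_ring A (Linf M) \<Longrightarrow> self_adjoint M A"
  shows "vectorspace.fin_dim class_ring (Linf M)"
proof (rule ccontr)
  assume "\<not> vectorspace.fin_dim class_ring (Linf M)"
  then have "\<not> finite_dim_on M (space M)" using fin_dim_if_finite_dim_on_space by blast
  then obtain X :: "nat \<Rightarrow> 'a set" where X: "\<And>n. X n \<in> sets M" "\<And>n. X (Suc n) \<subseteq> X n"
    "\<And>n. X n - X (Suc n) \<notin> null_sets M"
    using exists_strictly_decreasing_sets by metis
  define v where "v n = cis (1 / real (Suc n))" for n
  \<comment> \<open>The first index at which \<open>x\<close> has left the sequence is \<open>Suc n\<close> exactly on \<open>X n - X (Suc n)\<close>.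
    Points that never leave receive the arbitrary but fixed default of \<open>LEAST\<close>, which keeps \<open>f\<close>
    measurable and unimodular.\<close>
  define f where "f x = v (LEAST n. x \<notin> X n)" for x
  have [measurable]: "X n \<in> sets M" for n by (rule X(1))
  have "(\<lambda>x. LEAST n. x \<notin> X n) \<in> measurable M (count_space UNIV)" by measurable
  then have "f \<in> borel_measurable M" unfolding f_def by (rule measurable_compose) simp
  moreover have "norm (f x) = 1" for x by (simp add: f_def v_def)
  ultimately obtain q where q: "q \<noteq> 0" "AE x in M. poly q (f x) = 0"
    using self_adjoint_imp_unimodular_algebraic[OF sa] by blast
  have "poly q (v (Suc n)) = 0" for n
  proof (rule ccontr)
    assume nz: "poly q (v (Suc n)) \<noteq> 0"
    have "decseq X" using X(2) by (rule decseq_SucI)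
    have val: "f x = v (Suc n)" if x: "x \<in> X n - X (Suc n)" for x
    proof -
      have "(LEAST k. x \<notin> X k) = Suc n"
      proof (rule Least_equality)
        fix k assume "x \<notin> X k"
        then have "\<not> k \<le> n" using decseqD[OF \<open>decseq X\<close>, of k n] x by blast
        then show "Suc n \<le> k" by simp
      qed (use x in blast)
      then show ?thesis by (simp add: f_def)
    qed
    have "AE x in M. x \<notin> X n - X (Suc n)"
      using q(2)
    proof eventually_elim
      case (elim x)
      then have "f x \<noteq> v (Suc n)" using nz by auto
      then show ?case using val by blast
    qed
    then have "X n - X (Suc n) \<in> null_sets M"
      by (subst AE_iff_null_sets) auto
    then show False using X(3) by blast
  qed
  then have "range (\<lambda>n. v (Suc n)) \<subseteq> {z. poly q z = 0}" by blast
  then have "finite (range (\<lambda>n. v (Suc n)))"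
    using poly_roots_finite[OF q(1)] finite_subset by blast
  moreover have "inj (\<lambda>n. v (Suc n))"
    using inj_compose[OF inj_cis_inverse_Suc inj_Suc] by (simp add: v_def comp_def)
  ultimately show False by (simp add: finite_image_iff)
qed

theorem theorem1:
  fixes M :: "'a measure"
  shows "vectorspace.fin_dim class_ring (Linf M) \<longleftrightarrow>
    (\<forall>A. nonunital_subalgebra class_ring A (Linf M) \<longrightarrow> self_adjoint M A)"
  using fin_dim_imp_self_adjoint self_adjoint_imp_fin_dim by blast

end
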